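(* $V_5=S_5$. That is, every configuration of five harmonic homologies $H_0,\dots,H_4$ of the real projective plane with scalar product $H_4H_3H_2H_1H_0=cI$ preserves a nonzero quadratic form: there is a nonzero symmetric $3\times3$ matrix $Q$ with $H_i^\top QH_i=Q$ for $i=0,\dots,4$.
   Context: For a nonzero row vector (covector) $L$ and a nonzero column vector $O$ in $\mathbb{R}^3$ with $LO\ne0$, the harmonic homology with axis $L$ and centre $O$ is $H=I-2\,OL/(LO)$; it depends only on $L,O$ up to scaling. $V_5$ is the variety of configurations $(L_i,O_i)_{i=0}^{4}$ (each $L_i$, $O_i$ up to scaling, $L_iO_i\ne0$) for which the product $H_4H_3H_2H_1H_0$ of the corresponding harmonic homologies is a scalar matrix. For a configuration, let $M$ be the $15\times6$ matrix of the linear system in the six entries of a symmetric matrix $Q$ expressing the vanishing of the cross products $QO_i\times L_i^\top$, $i=0,\dots,4$; $\ker M$ is the space of invariant forms, i.e. of symmetric $Q$ with $H_i^\top QH_i=Q$ for all $i$. $S_5\subset V_5$ is the closed subset where $\operatorname{rank}M\le5$, i.e. of configurations with a nonzero invariant form. *)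

theory Defs
  imports "HOL-Analysis.Analysis"
begin

(* The real projective plane: nonzero triples up to nonzero scaling. The same type serves for
   centres (columns) and axes (rows), so LO is the inner product L \<bullet> O and OL is the outer product
   with entries O_r L_s. *)

definition proj_rel :: "real^3 \<Rightarrow> real^3 \<Rightarrow> bool"
  where "proj_rel x y \<longleftrightarrow> x \<noteq> 0 \<and> y \<noteq> 0 \<and> (\<exists>c. c \<noteq> 0 \<and> y = c *\<^sub>R x)"

lemma proj_relE:
  assumes "proj_rel x y"
  obtains c where "c \<noteq> 0" "x \<noteq> 0" "y = c *\<^sub>R x"
  using assms by (auto simp: proj_rel_def)

lemma proj_rel_sym: "proj_rel x y \<Longrightarrow> proj_rel y x"
  unfolding proj_rel_def
  by (metis (no_types) left_inverse nonzero_imp_inverse_nonzero scaleR_one scaleR_scaleR)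

lemma proj_rel_trans: "proj_rel x y \<Longrightarrow> proj_rel y z \<Longrightarrow> proj_rel x z"
  unfolding proj_rel_def by (metis mult_eq_0_iff scaleR_scaleR)

lemma part_equivp_proj_rel: "part_equivp proj_rel"
proof (rule part_equivpI)
  have "proj_rel (axis 1 1) (axis 1 1)"
    by (auto simp: proj_rel_def axis_eq_0_iff intro: exI[of _ 1])
  then show "\<exists>x. proj_rel x x" by blast
qed (auto intro: sympI transpI proj_rel_sym proj_rel_trans)

quotient_type rp2 = "real^3" / partial: proj_rel
  by (rule part_equivp_proj_rel)

lift_definition nonincident :: "rp2 \<Rightarrow> rp2 \<Rightarrow> bool" is "\<lambda>L O'. L \<bullet> O' \<noteq> 0"
  by (auto elim!: proj_relE)

lift_definition harmonic_homology :: "rp2 \<Rightarrow> rp2 \<Rightarrow> real^3^3"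
  is "\<lambda>L O'. mat 1 - (2 / (L \<bullet> O')) *\<^sub>R (\<chi> r s. O' $ r * L $ s)"
  by (auto elim!: proj_relE simp: vec_eq_iff)

(* A configuration sends i to the pair (L_i, O_i); the index type 5 has elements 0, ..., 4. *)

type_synonym configuration = "5 \<Rightarrow> rp2 \<times> rp2"

definition H :: "configuration \<Rightarrow> 5 \<Rightarrow> real^3^3"
  where "H C i = harmonic_homology (fst (C i)) (snd (C i))"

definition V5 :: "configuration set"
  where "V5 = {C. (\<forall>i. nonincident (fst (C i)) (snd (C i))) \<and>
                  (\<exists>c. H C 4 ** H C 3 ** H C 2 ** H C 1 ** H C 0 = mat c)}"

definition sym_matrix :: "real^6 \<Rightarrow> real^3^3"
  where "sym_matrix q = vector [vector [q$1, q$2, q$3],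
                                vector [q$2, q$4, q$5],
                                vector [q$3, q$5, q$6]]"

(* The 15 rows are indexed by pairs (i, k): the k-th coordinate of the i-th cross product. The matrix
   depends on the chosen representatives, but its rank does not. *)

definition M_rep :: "(5 \<Rightarrow> (real^3) \<times> (real^3)) \<Rightarrow> real^6^(5 \<times> 3)"
  where "M_rep R = matrix (\<lambda>q. \<chi> p. case p of (i, k) \<Rightarrow>
           cross3 (sym_matrix q *v snd (R i)) (fst (R i)) $ k)"

lemma rank_M_rep_le:
  assumes "\<And>i. proj_rel (fst (R i)) (fst (S i))" "\<And>i. proj_rel (snd (R i)) (snd (S i))"
  shows "rank (M_rep S) \<le> rank (M_rep R)"
proof -
  obtain a where a: "\<And>i. fst (S i) = a i *\<^sub>R fst (R i)"
    using assms(1) unfolding proj_rel_def by metis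
  obtain b where b: "\<And>i. snd (S i) = b i *\<^sub>R snd (R i)"
    using assms(2) unfolding proj_rel_def by metis
  define D :: "real^(5 \<times> 3)^(5 \<times> 3)"
    where "D = (\<chi> p p'. if p = p' then a (fst p) * b (fst p) else 0)"
  have "M_rep S = D ** M_rep R"
    by (simp add: vec_eq_iff M_rep_def matrix_def matrix_matrix_mult_def D_def a b
        matrix_vector_mult_scaleR cross_mult_left cross_mult_right if_distrib if_distribR
        sum.delta cong: if_cong)
  then show ?thesis
    by (simp add: rank_mul_le_right)
qed

lift_definition rank_M :: "configuration \<Rightarrow> nat" is "\<lambda>R. rank (M_rep R)"
  by (rule antisym; rule rank_M_rep_le)
     (auto simp: rel_fun_def rel_prod_sel intro: proj_rel_sym)

definition S5 :: "configuration set"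
  where "S5 = {C \<in> V5. rank_M C \<le> 5}"

end

theory Submission
  imports Defs
begin

text \<open>
  Let \<open>W\<close> be the six-dimensional space of symmetric forms and let \<open>T\<^sub>i Q = H\<^sub>i\<^sup>T Q H\<^sub>i\<close>. Scott's inequality
  for linear maps with trivial product (lemma \<open>scott_inequality\<close>) says that the sum of the ranks
  of the \<open>1 - T\<^sub>i\<close> is at least the codimension of the common fixed space plus the dimension of the
  span of the images of the \<open>1 - T\<^sub>i\<close>. A homology moves a form \<open>Q\<close> only by a symmetrised product
  of its axis with a covector that vanishes at its centre, so each rank is at most 2 and the sum at
  most 10. The orthogonal complement in \<open>W\<close> of the span of the images is the space of dual
  forms \<open>S\<close> with \<open>H\<^sub>i S H\<^sub>i\<^sup>T = S\<close>. Hence the dimensions of the spaces of invariant forms and of invariant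
  dual forms add up to at least \<open>2 \<sqdot> 6 - 10 = 2\<close>.

  Suppose that there is no nonzero invariant form. Then the invariant dual forms fill at least two
  dimensions, and some nonzero one among them, \<open>S\<close>, has trace zero. Its cofactor matrix is an
  invariant form, because taking cofactor matrices is multiplicative and sends an involution to
  its transpose up to sign (lemma \<open>pullback_cofactor_matrix\<close>). It is nonzero because its trace is
  \<open>((tr S)\<^sup>2 - tr (S\<^sup>2)) / 2 = - tr (S\<^sup>2) / 2 < 0\<close>; this is where real coefficients matter. So a
  nonzero invariant form \<open>Q\<close> exists in every case. For such a \<open>Q\<close>, the polar covector of each
  centre is proportional to the corresponding axis, so the six entries of \<open>Q\<close> form a nonzero kernel vector
  of the \<open>15 \<times> 6\<close> matrix, whose rank is therefore at most 5.
\<close>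

section \<open>Scott's inequality\<close>

lemma rank_nullity:
  fixes f :: "'a::euclidean_space \<Rightarrow> 'b::euclidean_space"
  assumes "linear f" "subspace S"
  shows "dim (f ` S) + dim {x\<in>S. f x = 0} = dim S"
proof -
  define K where "K = {x\<in>S. f x = 0}"
  \<comment> \<open>\<open>f\<close> maps the orthogonal complement of its kernel bijectively onto its image.\<close>
  define N where "N = {y\<in>S. \<forall>x\<in>K. orthogonal x y}"
  have K: "subspace K" "K \<subseteq> S"
    using assms by (auto simp: K_def subspace_def linear_0 linear_add linear_scale)
  have N: "subspace N"
    using assms(2) by (auto simp: N_def subspace_def orthogonal_def inner_right_distrib)
  have "dim N + dim K = dim S"
    unfolding N_def by (rule dim_subspace_orthogonal_to_vectors) (use K assms in auto)
  moreover have "f ` N = f ` S"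
  proof
    show "f ` S \<subseteq> f ` N"
    proof clarify
      fix x assume x: "x \<in> S"
      obtain y z where yz: "y \<in> span K" "\<And>w. w \<in> span K \<Longrightarrow> orthogonal z w" "x = y + z"
        using orthogonal_subspace_decomp_exists by blast
      have y: "y \<in> K" using yz(1) K(1) span_eq_iff by blast
      have "z = x - y" using yz by simp
      with x y K assms have "z \<in> S" by (auto intro: subspace_diff)
      then have "z \<in> N" using yz(2) K by (auto simp: N_def orthogonal_commute span_base)
      moreover have "f x = f z" using y yz(3) assms by (simp add: K_def linear_add)
      ultimately show "f x \<in> f ` N" by blast
    qed
  qed (auto simp: N_def)
  moreover have "dim (f ` N) = dim N"
  proof (rule dim_image_eq[OF assms(1)])
    have "x = y" if "x \<in> N" "y \<in> N" "f x = f y" for x y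
    proof -
      have "x - y \<in> N" using that N by (auto intro: subspace_diff)
      moreover have "x - y \<in> K"
        using that assms by (auto simp: K_def N_def linear_diff intro: subspace_diff)
      ultimately have "orthogonal (x - y) (x - y)" by (auto simp: N_def)
      then show ?thesis by (simp add: orthogonal_self)
    qed
    then show "inj_on f (span N)" using N by (metis inj_onI span_eq_iff)
  qed
  ultimately show ?thesis by (simp add: K_def)
qed

text \<open>
  When the maps \<open>g i\<close> sum to zero, the diagonal map sends \<open>W\<close> into the kernel of the addition map
  from the direct sum of the images onto their span, and counting dimensions in this complex gives
  the inequality. The last summand on the right, which measures how far the sum is from zero, makes
  an induction over the index set possible, so that no direct sum has to be formed.
\<close>

lemma dim_linear_family:
  fixes g :: "'i \<Rightarrow> 'a::euclidean_space \<Rightarrow> 'b::euclidean_space"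
  assumes W: "subspace W" and I: "finite I" and lin: "\<And>i. i \<in> I \<Longrightarrow> linear (g i)"
  shows "dim (span (\<Union>i\<in>I. g i ` W)) + dim W
    \<le> (\<Sum>i\<in>I. dim (g i ` W)) + dim {w\<in>W. \<forall>i\<in>I. g i w = 0} + dim ((\<lambda>w. \<Sum>i\<in>I. g i w) ` W)"
  using I lin
proof (induction I)
  case empty
  then show ?case by simp
next
  case (insert j I)
  define G where "G = (\<lambda>w. \<Sum>i\<in>I. g i w)"
  define A where "A = span (\<Union>i\<in>I. g i ` W)"
  define B where "B = g j ` W"
  define K where "K = {w\<in>W. \<forall>i\<in>I. g i w = 0}"
  define Z where "Z = {w\<in>W. G w = 0}"
  define N where "N = {w\<in>W. G w + g j w = 0}"
  have gj: "linear (g j)" and gi: "\<And>i. i \<in> I \<Longrightarrow> linear (g i)" using insert.prems by auto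
  have G: "linear G" unfolding G_def using gi by (intro linear_compose_sum) auto
  have Gj: "linear (\<lambda>w. G w + g j w)" using G gj by (rule linear_compose_add)
  have sub: "subspace A" "subspace B" "subspace K" "subspace Z" "subspace N" "subspace (N \<inter> Z)"
  proof -
    show "subspace A" by (simp add: A_def)
    show "subspace B" unfolding B_def using gj W by (rule linear_subspace_image)
    show "subspace K" using W gi by (auto simp: K_def subspace_def linear_0 linear_add linear_scale)
    show Z: "subspace Z" using W G by (auto simp: Z_def subspace_def linear_0 linear_add linear_scale)
    show N: "subspace N" using W Gj unfolding N_def subspace_def
      by (auto simp: linear_0[OF Gj] linear_add[OF Gj] linear_scale[OF Gj])
    show "subspace (N \<inter> Z)" using Z N by (rule subspace_inter[rotated])
  qed
  have IH: "dim A + dim W \<le> (\<Sum>i\<in>I. dim (g i ` W)) + dim K + dim (G ` W)"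
    using insert.IH gi by (simp add: A_def K_def G_def)
  have AB: "dim {x + y |x y. x \<in> A \<and> y \<in> B} + dim (A \<inter> B) = dim A + dim B"
    by (rule dim_sums_Int) (use sub in auto)
  have "span (\<Union>i\<in>insert j I. g i ` W) = {x + y |x y. x \<in> A \<and> y \<in> B}"
  proof -
    have "span (\<Union>i\<in>insert j I. g i ` W) = span ((\<Union>i\<in>I. g i ` W) \<union> B)"
      by (simp add: B_def Un_commute)
    also have "\<dots> = {x + y |x y. x \<in> A \<and> y \<in> span B}"
      unfolding span_Un A_def by auto
    finally show ?thesis using sub(2) by (simp add: span_eq_iff[THEN iffD2])
  qed
  note span_eq = this
  \<comment> \<open>On \<open>N\<close> the maps \<open>G\<close> and \<open>- g j\<close> agree, so \<open>G\<close> sends \<open>N\<close> into both spans; the overlap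
    \<open>A \<inter> B\<close> is exactly what the dimension of \<open>A + B\<close> loses against \<open>dim A + dim B\<close>.\<close>
  have "G ` N \<subseteq> A \<inter> B"
  proof clarify
    fix w assume w: "w \<in> N"
    have "G w \<in> A" unfolding G_def A_def using w by (intro span_sum span_base) (auto simp: N_def)
    moreover have "G w = - g j w" using w by (simp add: N_def eq_neg_iff_add_eq_0)
    then have "G w = g j (- w)" using linear_neg[OF gj, of w] by metis
    moreover have "- w \<in> W" using w W by (auto simp: N_def subspace_neg)
    ultimately show "G w \<in> A \<inter> B" by (auto simp: B_def)
  qed
  then have 1: "dim (G ` N) \<le> dim (A \<inter> B)" by (rule dim_subset)
  have 2: "dim (G ` N) + dim (N \<inter> Z) = dim N"
  proof -
    have "{x\<in>N. G x = 0} = N \<inter> Z" by (auto simp: N_def Z_def)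
    then show ?thesis using rank_nullity[OF G sub(5)] by simp
  qed
  have 3: "dim (G ` W) + dim Z = dim W"
    using rank_nullity[OF G W] by (simp add: Z_def)
  have 4: "dim ((\<lambda>w. G w + g j w) ` W) + dim N = dim W"
    using rank_nullity[OF Gj W] by (simp add: N_def)
  \<comment> \<open>\<open>(N \<inter> Z) / (N \<inter> K)\<close> embeds into \<open>Z / K\<close>, and \<open>N \<inter> K\<close> is the common kernel of the larger family.\<close>
  have KZ: "K \<subseteq> Z" by (auto simp: K_def Z_def G_def)
  have "dim {x + y |x y. x \<in> N \<inter> Z \<and> y \<in> K} + dim (N \<inter> Z \<inter> K) = dim (N \<inter> Z) + dim K"
    by (rule dim_sums_Int) (use sub in auto)
  moreover have "dim {x + y |x y. x \<in> N \<inter> Z \<and> y \<in> K} \<le> dim Z"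
    by (rule dim_subset) (use KZ sub(4) in \<open>auto intro: subspace_add\<close>)
  moreover have "N \<inter> Z \<inter> K = {w\<in>W. \<forall>i\<in>insert j I. g i w = 0}"
    using KZ by (auto simp: N_def Z_def K_def G_def)
  ultimately have 5: "dim (N \<inter> Z) + dim K \<le> dim Z + dim {w\<in>W. \<forall>i\<in>insert j I. g i w = 0}"
    by simp
  have 6: "(\<lambda>w. \<Sum>i\<in>insert j I. g i w) = (\<lambda>w. G w + g j w)"
    using insert.hyps by (simp add: G_def add.commute)
  have 7: "(\<Sum>i\<in>insert j I. dim (g i ` W)) = (\<Sum>i\<in>I. dim (g i ` W)) + dim B"
    using insert.hyps by (simp add: B_def)
  show ?case unfolding span_eq 6 7 using IH AB 1 2 3 4 5 by linarith
qed

primrec prefix_comp :: "(nat \<Rightarrow> 'a \<Rightarrow> 'a) \<Rightarrow> nat \<Rightarrow> 'a \<Rightarrow> 'a" where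
  "prefix_comp T 0 = id"
| "prefix_comp T (Suc k) = prefix_comp T k \<circ> T k"

text \<open>
  With \<open>f k\<close> the composition of the first \<open>k\<close> maps, the differences \<open>g k = f k - f (k + 1)\<close> telescope
  to zero on \<open>W\<close>. Since \<open>g k = f k \<circ> (1 - T k)\<close> and \<open>f k\<close> is injective on \<open>W\<close>, the kernels of the
  \<open>g k\<close> are the fixed spaces of the \<open>T k\<close> and their ranks do not exceed those of \<open>1 - T k\<close>.
\<close>

lemma scott_inequality:
  fixes T :: "nat \<Rightarrow> 'a::euclidean_space \<Rightarrow> 'a"
  assumes W: "subspace W" and lin: "\<And>k. linear (T k)"
    and TW: "\<And>k w. w \<in> W \<Longrightarrow> T k w \<in> W" and inj: "\<And>k. inj_on (T k) W"
    and prod: "\<And>w. w \<in> W \<Longrightarrow> prefix_comp T n w = w"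
  shows "dim (span (\<Union>k<n. (\<lambda>w. w - T k w) ` W)) + dim W
    \<le> (\<Sum>k<n. dim ((\<lambda>w. w - T k w) ` W)) + dim {w\<in>W. \<forall>k<n. T k w = w}"
proof -
  define f where "f = prefix_comp T"
  define g where "g = (\<lambda>k w. f k (w - T k w))"
  define A where "A = span (\<Union>k<n. g k ` W)"
  have f0: "f 0 w = w" and fS: "f (Suc k) w = f k (T k w)" for k w by (simp_all add: f_def)
  have linf: "linear (f k)" for k
    unfolding f_def by (induction k) (simp_all add: linear_id[unfolded id_def] id_def linear_compose lin del: o_apply)
  have linT: "linear (\<lambda>w. w - T k w)" for k
    by (intro linear_compose_sub lin linear_ident)
  have ling: "linear (g k)" for k
    using linear_compose[OF linT[of k] linf[of k]] by (simp add: g_def comp_def)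
  have TW': "w - T k w \<in> W" if "w \<in> W" for k w using that W TW by (auto intro: subspace_diff)
  have injf: "f k v = f k w \<Longrightarrow> v \<in> W \<Longrightarrow> w \<in> W \<Longrightarrow> v = w" for k v w
  proof (induction k arbitrary: v w)
    case (Suc k)
    then have "T k v = T k w" using TW by (auto simp: fS)
    with Suc.prems inj show ?case by (auto dest: inj_onD)
  qed (simp add: f0)
  have partial: "(\<Sum>k<m. g k w) = w - f m w" for m w
    by (induction m) (simp_all add: f0 fS g_def linear_diff[OF linf])
  \<comment> \<open>\<open>v = w - T k w\<close> differs from \<open>f k v = g k w\<close> by a sum of values of the \<open>g i\<close> with \<open>i < k\<close>.\<close>
  have "w - T k w \<in> A" if k: "k < n" and w: "w \<in> W" for k w
  proof -
    have "(\<Sum>i<k. g i (w - T k w)) \<in> A"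
      unfolding A_def
    proof (intro span_sum span_base)
      fix i assume "i \<in> {..<k}"
      then have "i \<in> {..<n}" using k by simp
      then show "g i (w - T k w) \<in> (\<Union>k<n. g k ` W)" using TW'[OF w] by blast
    qed
    moreover have "g k w \<in> A" unfolding A_def using k w by (intro span_base) auto
    ultimately have "(\<Sum>i<k. g i (w - T k w)) + g k w \<in> A"
      unfolding A_def by (rule span_add)
    moreover have "(\<Sum>i<k. g i v) + g k w = v" if "v = w - T k w" for v
      unfolding partial using that by (simp add: g_def)
    ultimately show ?thesis by simp
  qed
  then have "span (\<Union>k<n. (\<lambda>w. w - T k w) ` W) \<subseteq> A"
    unfolding A_def by (intro span_minimal) auto
  then have "dim (span (\<Union>k<n. (\<lambda>w. w - T k w) ` W)) \<le> dim A" by (rule dim_subset)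
  moreover have "dim A + dim W \<le> (\<Sum>k<n. dim (g k ` W)) + dim {w\<in>W. \<forall>k\<in>{..<n}. g k w = 0}
      + dim ((\<lambda>w. \<Sum>k<n. g k w) ` W)"
    unfolding A_def by (rule dim_linear_family) (use W ling in auto)
  moreover have "dim ((\<lambda>w. \<Sum>k<n. g k w) ` W) = 0"
    using prod by (auto simp: partial f_def)
  moreover have "(\<Sum>k<n. dim (g k ` W)) \<le> (\<Sum>k<n. dim ((\<lambda>w. w - T k w) ` W))"
  proof (rule sum_mono)
    fix k
    have "g k ` W = f k ` ((\<lambda>w. w - T k w) ` W)" by (auto simp: g_def)
    then show "dim (g k ` W) \<le> dim ((\<lambda>w. w - T k w) ` W)" using dim_image_le[OF linf] by metis
  qed
  moreover have "{w\<in>W. \<forall>k\<in>{..<n}. g k w = 0} = {w\<in>W. \<forall>k<n. T k w = w}"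
  proof -
    have "g k w = 0 \<longleftrightarrow> T k w = w" if "w \<in> W" for k w
      using that injf[of k "w - T k w" 0] TW'[OF that] W linear_0[OF linf]
      by (auto simp: g_def subspace_0)
    then show ?thesis by auto
  qed
  ultimately show ?thesis by simp
qed

section \<open>Symmetric forms and their pullbacks\<close>

definition symmetric_forms :: "(real^'n^'n) set"
  where "symmetric_forms = {Q. transpose Q = Q}"

definition pullback :: "real^'n^'n \<Rightarrow> real^'n^'n \<Rightarrow> real^'n^'n"
  where "pullback A Q = transpose A ** Q ** A"

lemma transpose_add: "transpose (A + B) = transpose A + transpose (B :: real^'n^'m)"
  by (simp add: transpose_def vec_eq_iff)

lemma matrix_mult_scaleR:
  fixes A :: "real^'n^'m" and B :: "real^'p^'n"
  shows "(c *\<^sub>R A) ** B = c *\<^sub>R (A ** B)" "A ** (c *\<^sub>R B) = c *\<^sub>R (A ** B)"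
  by (simp_all add: matrix_scalar_ac scalar_matrix_assoc)

lemma symmetric_forms_nth:
  assumes "Q \<in> symmetric_forms"
  shows "Q $ i $ j = Q $ j $ i"
proof -
  have "transpose Q $ i $ j = Q $ j $ i" by (simp add: transpose_def)
  then show ?thesis using assms by (simp add: symmetric_forms_def)
qed

lemma subspace_symmetric_forms: "subspace symmetric_forms"
  by (auto simp: subspace_def symmetric_forms_def transpose_add transpose_scalar)
     (simp add: transpose_def vec_eq_iff)

lemma linear_pullback: "linear (pullback A)"
  by (rule linearI)
     (auto simp: pullback_def vec_eq_iff matrix_matrix_mult_def sum.distrib sum_distrib_left
       sum_distrib_right algebra_simps)

lemma pullback_symmetric: "Q \<in> symmetric_forms \<Longrightarrow> pullback A Q \<in> symmetric_forms"
  by (simp add: symmetric_forms_def pullback_def matrix_transpose_mul matrix_mul_assoc)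

lemma pullback_pullback: "pullback A (pullback B Q) = pullback (B ** A) Q"
  by (simp add: pullback_def matrix_transpose_mul matrix_mul_assoc)

lemma pullback_mat:
  fixes Q :: "real^'n^'n"
  shows "pullback (mat c) Q = c\<^sup>2 *\<^sub>R Q"
proof -
  have "mat c = c *\<^sub>R (mat 1 :: real^'n^'n)" by (simp add: mat_def vec_eq_iff)
  then show ?thesis
    by (simp only: pullback_def transpose_scalar transpose_mat matrix_mult_scaleR power2_eq_square
        scaleR_scaleR matrix_mul_lid matrix_mul_rid)
qed

text \<open>
  With respect to the trace pairing, the adjoint of the action on forms is the action on dual forms.
\<close>

lemma inner_pullback:
  fixes A S Q :: "real^3^3"
  shows "S \<bullet> pullback A Q = pullback (transpose A) S \<bullet> Q"
proof -
  have l: "X \<bullet> (Y ** Z) = (transpose Y ** X) \<bullet> Z" for X Y Z :: "real^3^3"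
    by (simp add: inner_vec_def matrix_matrix_mult_def transpose_def sum_3 algebra_simps)
  have r: "X \<bullet> (Y ** Z) = (X ** transpose Z) \<bullet> Y" for X Y Z :: "real^3^3"
    by (simp add: inner_vec_def matrix_matrix_mult_def transpose_def sum_3 algebra_simps)
  show ?thesis unfolding pullback_def by (subst r, subst l) (simp add: matrix_mul_assoc)
qed

lemma linear_sym_matrix: "linear sym_matrix"
  by (rule linearI) (simp_all add: sym_matrix_def vec_eq_iff forall_3)

lemma range_sym_matrix: "range sym_matrix = symmetric_forms"
proof
  show "range sym_matrix \<subseteq> symmetric_forms"
    by (auto simp: sym_matrix_def symmetric_forms_def transpose_def vec_eq_iff forall_3)
  show "symmetric_forms \<subseteq> range sym_matrix"
  proof
    fix Q :: "real^3^3" assume "Q \<in> symmetric_forms"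
    then have Q: "Q$2$1 = Q$1$2" "Q$3$1 = Q$1$3" "Q$3$2 = Q$2$3"
      by (simp_all only: symmetric_forms_nth)
    define q :: "real^6" where "q = (\<chi> i. if i = 1 then Q$1$1 else if i = 2 then Q$1$2
      else if i = 3 then Q$1$3 else if i = 4 then Q$2$2 else if i = 5 then Q$2$3 else Q$3$3)"
    have "sym_matrix q = Q" by (simp add: sym_matrix_def q_def vec_eq_iff forall_3 Q)
    then show "Q \<in> range sym_matrix" by blast
  qed
qed

lemma forall_6: "(\<forall>i::6. P i) \<longleftrightarrow> P 1 \<and> P 2 \<and> P 3 \<and> P 4 \<and> P 5 \<and> P 6"
proof -
  have "x = 1 \<or> x = 2 \<or> x = 3 \<or> x = 4 \<or> x = 5 \<or> x = 6" for x :: 6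
  proof (induct x)
    case (of_int z)
    then have "z = 0 \<or> z = 1 \<or> z = 2 \<or> z = 3 \<or> z = 4 \<or> z = 5" by auto
    then show ?case by auto
  qed
  then show ?thesis by metis
qed

lemma inj_sym_matrix: "inj sym_matrix"
  by (rule injI) (simp add: sym_matrix_def vec_eq_iff forall_3 forall_6)

lemma dim_symmetric_forms: "dim (symmetric_forms :: (real^3^3) set) = 6"
proof -
  have "dim (range sym_matrix) = dim (UNIV :: (real^6) set)"
    by (rule dim_image_eq[OF linear_sym_matrix]) (simp add: inj_sym_matrix)
  then show ?thesis by (simp add: range_sym_matrix)
qed

section \<open>From invariant dual forms to invariant forms\<close>

text \<open>
  This is the transpose of the adjugate; unlike the adjugate, it preserves the order of products.
\<close>

definition cofactor_matrix :: "real^3^3 \<Rightarrow> real^3^3"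
  where "cofactor_matrix A = vector [cross3 (A$2) (A$3), cross3 (A$3) (A$1), cross3 (A$1) (A$2)]"

lemma cofactor_matrix_mult: "cofactor_matrix (A ** B) = cofactor_matrix A ** cofactor_matrix B"
  by (simp add: cofactor_matrix_def cross3_def vec_eq_iff forall_3 matrix_matrix_mult_def sum_3)
     (simp add: algebra_simps)

lemma cofactor_matrix_transpose: "cofactor_matrix (transpose A) = transpose (cofactor_matrix A)"
  by (simp add: cofactor_matrix_def cross3_def vec_eq_iff forall_3 transpose_def)

lemma mult_transpose_cofactor_matrix: "A ** transpose (cofactor_matrix A) = det A *\<^sub>R mat 1"
  by (simp add: cofactor_matrix_def cross3_def vec_eq_iff forall_3 transpose_def
      matrix_matrix_mult_def sum_3 det_3 mat_def algebra_simps)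

lemma involution_det: "A ** A = mat 1 \<Longrightarrow> (det (A :: real^'n^'n))\<^sup>2 = 1"
  by (metis det_I det_mul power2_eq_square)

lemma cofactor_matrix_involution:
  assumes "A ** A = mat 1"
  shows "cofactor_matrix A = det A *\<^sub>R transpose A"
proof -
  have "transpose (cofactor_matrix A) = (A ** A) ** transpose (cofactor_matrix A)"
    by (simp add: assms)
  also have "\<dots> = det A *\<^sub>R A"
    by (simp add: matrix_mul_assoc[symmetric] mult_transpose_cofactor_matrix matrix_mult_scaleR)
  finally show ?thesis by (metis transpose_scalar transpose_transpose)
qed

text \<open>
  Taking cofactor matrices in \<open>S = A S A\<^sup>T\<close> replaces \<open>A\<close> by \<open>det A\<close> times \<open>A\<^sup>T\<close>, and the sign
  \<open>det A\<close> enters twice.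
\<close>

lemma pullback_cofactor_matrix:
  assumes "A ** A = mat 1" "pullback (transpose A) S = S"
  shows "pullback A (cofactor_matrix S) = cofactor_matrix S"
proof -
  let ?C = "cofactor_matrix S"
  have "?C = cofactor_matrix A ** ?C ** transpose (cofactor_matrix A)"
    using arg_cong[OF assms(2), of cofactor_matrix]
    by (simp add: pullback_def cofactor_matrix_mult cofactor_matrix_transpose)
  also have "\<dots> = (det A)\<^sup>2 *\<^sub>R pullback A ?C"
    by (simp add: cofactor_matrix_involution[OF assms(1)] transpose_scalar pullback_def
       power2_eq_square matrix_mult_scaleR)
  finally show ?thesis by (simp add: involution_det[OF assms(1)])
qed

text \<open>
  The trace of the cofactor matrix is the second elementary symmetric function of the eigenvalues.
  If these are real with sum zero, it is negative unless all of them vanish.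
\<close>

lemma cofactor_matrix_nonzero:
  assumes S: "S \<in> symmetric_forms" "S \<noteq> 0" and tr: "S \<bullet> mat 1 = 0"
  shows "cofactor_matrix S \<noteq> 0"
proof
  assume "cofactor_matrix S = 0"
  then have "cofactor_matrix S \<bullet> mat 1 = 0" by simp
  moreover have "2 * (cofactor_matrix S \<bullet> mat 1) = (S \<bullet> mat 1)\<^sup>2 - S \<bullet> S"
    by (simp add: cofactor_matrix_def cross3_def inner_vec_def sum_3 mat_def power2_eq_square
        symmetric_forms_nth[OF S(1), of 2 1] symmetric_forms_nth[OF S(1), of 3 1]
        symmetric_forms_nth[OF S(1), of 3 2] algebra_simps)
  ultimately show False using S(2) tr by simp
qed

section \<open>Harmonic homologies\<close>

definition outer :: "real^3 \<Rightarrow> real^3 \<Rightarrow> real^3^3"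
  where "outer x y = (\<chi> r s. x $ r * y $ s)"

definition homology_matrix :: "real^3 \<Rightarrow> real^3 \<Rightarrow> real^3^3"
  where "homology_matrix L P = mat 1 - (2 / (L \<bullet> P)) *\<^sub>R outer P L"

lemma outer_apply: "outer x y *v z = (y \<bullet> z) *\<^sub>R x"
  by (simp add: outer_def matrix_vector_mult_def inner_vec_def vec_eq_iff sum_3 algebra_simps)

lemma homology_matrix_apply:
  "homology_matrix L P *v x = x - (2 / (L \<bullet> P) * (L \<bullet> x)) *\<^sub>R P"
  by (simp add: homology_matrix_def matrix_vector_mult_diff_rdistrib outer_apply
      scaleR_matrix_vector_assoc[symmetric])

lemma transpose_homology_matrix: "transpose (homology_matrix L P) = homology_matrix P L"
  by (simp add: homology_matrix_def outer_def transpose_def mat_def vec_eq_iff inner_commute mult.commute)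

lemma homology_matrix_involution:
  assumes "L \<bullet> P \<noteq> 0"
  shows "homology_matrix L P ** homology_matrix L P = mat 1"
proof -
  have "homology_matrix L P *v (homology_matrix L P *v x) = x" for x
    using assms by (simp add: homology_matrix_apply inner_diff_right algebra_simps flip: scaleR_add_left)
  then show ?thesis by (simp add: matrix_eq matrix_vector_mul_assoc[symmetric])
qed

text \<open>
  Expanding \<open>H\<^sup>T Q H\<close> for \<open>H = 1 - s P L\<close> gives a linear term and a quadratic multiple of \<open>L L\<^sup>T\<close>. The
  covector \<open>u\<close> collects the linear term and half of the quadratic one, and it vanishes at \<open>P\<close>
  because \<open>s (L \<bullet> P) = 2\<close>.
\<close>

lemma moved_forms_homology:
  assumes LP: "L \<bullet> P \<noteq> 0" and Q: "Q \<in> symmetric_forms"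
  obtains u where "P \<bullet> u = 0" "Q - pullback (homology_matrix L P) Q = outer L u + outer u L"
proof
  define s where "s = 2 / (L \<bullet> P)"
  let ?u = "s *\<^sub>R (Q *v P) - (s\<^sup>2 / 2 * (P \<bullet> (Q *v P))) *\<^sub>R L"
  have "s * (L \<bullet> P) = 2" using LP by (simp add: s_def)
  then show "P \<bullet> ?u = 0"
    by (simp add: inner_diff_right inner_commute[of P L] power2_eq_square algebra_simps)
  have sym: "P \<bullet> (Q *v x) = (Q *v P) \<bullet> x" for x
    using Q dot_lmul_matrix[of P Q x] by (simp add: symmetric_forms_def flip: transpose_matrix_vector)
  have apply_homology: "homology_matrix L P *v x = x - (s * (L \<bullet> x)) *\<^sub>R P"
    "transpose (homology_matrix L P) *v x = x - (s * (P \<bullet> x)) *\<^sub>R L" for x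
    by (simp_all add: transpose_homology_matrix homology_matrix_apply s_def inner_commute)
  have "(Q - pullback (homology_matrix L P) Q) *v x = (outer L ?u + outer ?u L) *v x" for x
  proof -
    have "pullback (homology_matrix L P) Q *v x
        = Q *v x - (s * (L \<bullet> x)) *\<^sub>R (Q *v P)
          - (s * ((Q *v P) \<bullet> x) - s\<^sup>2 * (L \<bullet> x) * (P \<bullet> (Q *v P))) *\<^sub>R L"
      unfolding pullback_def matrix_vector_mul_assoc[symmetric] apply_homology
        matrix_vector_mult_diff_distrib matrix_vector_mult_scaleR
      by (simp add: inner_diff_right sym power2_eq_square algebra_simps)
    moreover have "(outer L ?u + outer ?u L) *v x = (s * (L \<bullet> x)) *\<^sub>R (Q *v P)
          + (s * ((Q *v P) \<bullet> x) - s\<^sup>2 * (L \<bullet> x) * (P \<bullet> (Q *v P))) *\<^sub>R L"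
      by (simp add: vec_eq_iff matrix_vector_mult_add_rdistrib outer_apply inner_diff_left field_simps)
    ultimately show ?thesis by (simp add: matrix_vector_mult_diff_rdistrib)
  qed
  then show "Q - pullback (homology_matrix L P) Q = outer L ?u + outer ?u L"
    by (simp add: matrix_eq)
qed

lemma dim_moved_forms_homology:
  assumes "L \<bullet> P \<noteq> 0"
  shows "dim ((\<lambda>Q. Q - pullback (homology_matrix L P) Q) ` symmetric_forms) \<le> 2"
proof -
  have P: "P \<noteq> 0" using assms by auto
  let ?h = "\<lambda>u. outer L u + outer u L"
  have "linear ?h" by (rule linearI) (simp_all add: outer_def vec_eq_iff algebra_simps)
  have "(\<lambda>Q. Q - pullback (homology_matrix L P) Q) ` symmetric_forms \<subseteq> ?h ` {u. P \<bullet> u = 0}"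
  proof (rule image_subsetI)
    fix Q :: "real^3^3" assume "Q \<in> symmetric_forms"
    then obtain u where "P \<bullet> u = 0" "Q - pullback (homology_matrix L P) Q = ?h u"
      using moved_forms_homology[OF assms] by metis
    then show "Q - pullback (homology_matrix L P) Q \<in> ?h ` {u. P \<bullet> u = 0}" by simp
  qed
  then have "dim ((\<lambda>Q. Q - pullback (homology_matrix L P) Q) ` symmetric_forms)
      \<le> dim (?h ` {u. P \<bullet> u = 0})" by (rule dim_subset)
  also have "\<dots> \<le> dim {u. P \<bullet> u = 0}" by (rule dim_image_le) fact
  also have "\<dots> = 2" using dim_hyperplane[OF P] by simp
  finally show ?thesis .
qed

text \<open>
  The centre \<open>P\<close> spans the \<open>-1\<close> eigenspace of \<open>H\<close>, so \<open>Q P\<close> lies in the \<open>-1\<close> eigenspace of \<open>H\<^sup>T\<close>,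
  which the axis \<open>L\<close> spans.
\<close>

lemma invariant_form_polarity:
  assumes LP: "L \<bullet> P \<noteq> 0" and Q: "pullback (homology_matrix L P) Q = Q"
  shows "cross3 (Q *v P) L = 0"
proof -
  let ?A = "homology_matrix L P"
  define k where "k = 2 / (P \<bullet> L) * (P \<bullet> (Q *v P))"
  have "?A *v P = (- 1) *\<^sub>R P"
    using LP by (simp add: homology_matrix_apply scaleR_2)
  then have "Q *v P = (- 1) *\<^sub>R (transpose ?A *v (Q *v P))"
    using arg_cong[OF Q, of "\<lambda>X. X *v P"]
    by (simp only: pullback_def matrix_vector_mul_assoc[symmetric] matrix_vector_mult_scaleR)
  also have "\<dots> = k *\<^sub>R L - Q *v P"
    by (simp add: transpose_homology_matrix homology_matrix_apply k_def)
  finally have "(Q *v P) $ i = k * L $ i - (Q *v P) $ i" for i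
    by (metis vector_minus_component vector_scaleR_component real_scaleR_def)
  then have "Q *v P = (k / 2) *\<^sub>R L" by (auto simp: vec_eq_iff field_simps)
  then show ?thesis by (metis cross_mult_left cross_refl scaleR_zero_right)
qed

section \<open>Five involutions with scalar product\<close>

text \<open>
  The argument uses homologies only through the involution property and the rank bound. The bound 2
  is critical: five such maps on a six-dimensional space leave exactly the room needed for a nonzero trace-free
  invariant dual form when no nonzero form is invariant.
\<close>

lemma invariant_form_exists:
  fixes A :: "nat \<Rightarrow> real^3^3"
  assumes inv: "\<And>k. A k ** A k = mat 1"
    and moved: "\<And>k. dim ((\<lambda>Q. Q - pullback (A k) Q) ` symmetric_forms) \<le> 2"
    and prod: "A 4 ** A 3 ** A 2 ** A 1 ** A 0 = mat c"
  obtains Q where "Q \<noteq> 0" "Q \<in> symmetric_forms" "\<And>k. k < 5 \<Longrightarrow> pullback (A k) Q = Q"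
proof (cases "\<exists>Q\<in>symmetric_forms. Q \<noteq> 0 \<and> (\<forall>k<5. pullback (A k) Q = Q)")
  case True
  then show ?thesis using that by blast
next
  case False
  define T where "T = (\<lambda>k. pullback (A k))"
  let ?W = "symmetric_forms :: (real^3^3) set"
  define D where "D = (\<Union>k<5. (\<lambda>Q. Q - T k Q) ` ?W)"
  have TT: "T k (T k Q) = Q" for k Q
    by (simp add: T_def pullback_pullback inv pullback_mat)
  have inj: "inj_on (pullback (A k)) ?W" for k
    using TT by (intro inj_on_inverseI[where g = "pullback (A k)"]) (simp add: T_def)
  \<comment> \<open>Each determinant is \<open>1\<close> or \<open>-1\<close>, so the scalar is \<open>1\<close> or \<open>-1\<close> and acts trivially on forms.\<close>
  have "(det (mat c :: real^3^3))\<^sup>2 = 1"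
    unfolding prod[symmetric] det_mul power_mult_distrib involution_det[OF inv] by simp
  then have "(c\<^sup>2) ^ 3 = 1" by (simp add: det_3 mat_def power_mult_distrib eval_nat_numeral algebra_simps)
  then have c: "c\<^sup>2 = 1" using power_eq_1_iff[of "c\<^sup>2" 3] by simp
  have "prefix_comp T 5 Q = Q" for Q
    using prod
    by (simp add: eval_nat_numeral T_def pullback_pullback matrix_mul_assoc)
       (metis c pullback_mat scaleR_one One_nat_def)
  then have "dim (span D) + dim ?W \<le> (\<Sum>k<5. dim ((\<lambda>w. w - T k w) ` ?W))
      + dim {w\<in>?W. \<forall>k<5. T k w = w}"
    unfolding D_def
    by (intro scott_inequality subspace_symmetric_forms)
       (simp_all add: T_def linear_pullback pullback_symmetric inj)
  moreover have "(\<Sum>k<5. dim ((\<lambda>w. w - T k w) ` ?W)) \<le> (\<Sum>k<(5::nat). 2)"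
    by (rule sum_mono) (simp add: T_def moved)
  moreover have "{w\<in>?W. \<forall>k<5. T k w = w} \<subseteq> {0}" using False by (auto simp: T_def)
  then have "dim {w\<in>?W. \<forall>k<5. T k w = w} = 0" by (simp only: dim_eq_0)
  ultimately have "dim D \<le> 4" by (simp add: dim_symmetric_forms)
  \<comment> \<open>Pairing with the identity matrix is the trace, so orthogonality to it is the condition of trace zero.\<close>
  then have "dim (insert (mat 1) D) < dim ?W" by (simp add: dim_insert dim_symmetric_forms)
  have DW: "D \<subseteq> ?W"
    by (auto simp: D_def T_def intro!: subspace_diff subspace_symmetric_forms pullback_symmetric)
  have spanW: "span ?W = ?W" using subspace_symmetric_forms span_eq_iff by blast
  have "insert (mat 1) D \<subseteq> ?W" using DW by (simp add: symmetric_forms_def transpose_mat)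
  with spanW have "span (insert (mat 1) D) \<subset> span ?W"
    using \<open>dim (insert (mat 1) D) < dim ?W\<close> by (metis dim_span order_less_irrefl psubsetI span_mono)
  then obtain S where S: "S \<noteq> 0" "S \<in> ?W" and orth: "\<And>y. y \<in> span (insert (mat 1) D) \<Longrightarrow> orthogonal S y"
    using orthogonal_to_subspace_exists_gen spanW by metis
  have dual: "pullback (transpose (A k)) S = S" if k: "k < 5" for k
  proof -
    \<comment> \<open>\<open>S\<close> is orthogonal to \<open>Y - T k Y\<close>, which by adjointness means that \<open>Y\<close> is orthogonal to itself.\<close>
    define Y where "Y = S - pullback (transpose (A k)) S"
    have Y: "Y \<in> ?W" unfolding Y_def
      by (intro subspace_diff subspace_symmetric_forms pullback_symmetric S)
    have "Y - T k Y \<in> span (insert (mat 1) D)" using Y k by (auto simp: D_def intro!: span_base)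
    from orth[OF this] have "S \<bullet> (Y - T k Y) = 0" by (simp add: orthogonal_def)
    then have "(S - pullback (transpose (A k)) S) \<bullet> Y = 0"
      by (simp add: T_def inner_diff_right inner_diff_left inner_pullback)
    then have "Y \<bullet> Y = 0" by (simp only: Y_def)
    then show ?thesis by (simp add: Y_def)
  qed
  have "S \<bullet> mat 1 = 0" using orth[of "mat 1"] by (simp add: orthogonal_def span_base)
  then have "cofactor_matrix S \<noteq> 0" using S cofactor_matrix_nonzero by blast
  moreover have "cofactor_matrix S \<in> ?W"
    using S(2) cofactor_matrix_transpose[of S] by (simp add: symmetric_forms_def)
  moreover have "pullback (A k) (cofactor_matrix S) = cofactor_matrix S" if "k < 5" for k
    using pullback_cofactor_matrix[OF inv dual[OF that]] .
  ultimately show ?thesis using that by blast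
qed

section \<open>The matrix of the linear system\<close>

lemma rank_M_rep_le_5:
  assumes Q: "Q \<in> symmetric_forms" "Q \<noteq> 0"
    and polar: "\<And>i. cross3 (Q *v snd (R i)) (fst (R i)) = 0"
  shows "rank (M_rep R) \<le> 5"
proof -
  obtain q where q: "Q = sym_matrix q" using Q(1) range_sym_matrix by blast
  let ?f = "\<lambda>q. \<chi> p. case p of (i, k) \<Rightarrow> cross3 (sym_matrix q *v snd (R i)) (fst (R i)) $ k"
  have "linear ?f"
    by (rule linearI)
       (auto simp: vec_eq_iff linear_add[OF linear_sym_matrix] linear_scale[OF linear_sym_matrix]
         matrix_vector_mult_add_rdistrib cross_add_left cross_mult_left scaleR_matrix_vector_assoc[symmetric])
  then have "M_rep R *v q = ?f q" unfolding M_rep_def by (simp only: matrix_works linear_matrix_vector_mul_eq)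
  also have "\<dots> = 0" using polar by (simp add: vec_eq_iff q)
  finally have "M_rep R *v q = M_rep R *v 0" by simp
  moreover have "q \<noteq> 0" using Q(2) q linear_0[OF linear_sym_matrix] by auto
  ultimately have "\<not> inj ((*v) (M_rep R))" by (meson injD)
  then have "rank (M_rep R) \<noteq> 6" using full_rank_injective[of "M_rep R"] by simp
  moreover have "rank (M_rep R) \<le> 6" using rank_bound[of "M_rep R"] by simp
  ultimately show ?thesis by linarith
qed

theorem corollary5p20:
  shows "V5 = S5 \<and>
    (\<forall>C \<in> V5. \<exists>Q :: real^3^3. Q \<noteq> 0 \<and> transpose Q = Q \<and>
       (\<forall>i. transpose (H C i) ** Q ** H C i = Q))"
proof -
  have main: "rank_M C \<le> 5 \<and> (\<exists>Q :: real^3^3. Q \<noteq> 0 \<and> transpose Q = Q \<and>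
       (\<forall>i. transpose (H C i) ** Q ** H C i = Q))" if C: "C \<in> V5" for C
  proof -
    define L where "L = (\<lambda>i. rep_rp2 (fst (C i)))"
    define P where "P = (\<lambda>i. rep_rp2 (snd (C i)))"
    have LP: "L i \<bullet> P i \<noteq> 0" for i
      using C by (simp add: V5_def nonincident_def L_def P_def)
    have H: "H C i = homology_matrix (L i) (P i)" for i
      by (simp add: H_def harmonic_homology_def homology_matrix_def outer_def L_def P_def)
    obtain c where c: "H C 4 ** H C 3 ** H C 2 ** H C 1 ** H C 0 = mat c"
      using C by (auto simp: V5_def)
    obtain Q where Q: "Q \<noteq> 0" "Q \<in> symmetric_forms" "\<And>k. k < 5 \<Longrightarrow> pullback (H C (of_nat k)) Q = Q"
    proof (rule invariant_form_exists[of "\<lambda>k. H C (of_nat k)" c])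
      show "H C (of_nat k) ** H C (of_nat k) = mat 1" for k
        by (simp add: H homology_matrix_involution LP)
      show "dim ((\<lambda>Q. Q - pullback (H C (of_nat k)) Q) ` symmetric_forms) \<le> 2" for k
        by (simp add: H dim_moved_forms_homology LP)
    qed (use c in auto)
    have inv: "pullback (H C i) Q = Q" for i
    proof (cases i)
      case (of_int z)
      then have "H C (of_nat (nat z)) = H C i" "nat z < 5" by auto
      then show ?thesis using Q(3) by metis
    qed
    have "rank (M_rep (\<lambda>i. (L i, P i))) \<le> 5"
      by (rule rank_M_rep_le_5[OF Q(2,1)]) (simp add: invariant_form_polarity LP inv flip: H)
    moreover have "rank_M C = rank (M_rep (\<lambda>i. (L i, P i)))"
      by (simp add: rank_M_def L_def P_def map_fun_def comp_def map_prod_def case_prod_beta)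
    ultimately show ?thesis using Q(1,2) inv by (auto simp: symmetric_forms_def pullback_def)
  qed
  then show ?thesis by (auto simp: S5_def)
qed

end
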